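(* Let $S=\{x_1,x_2,\dots,x_n\}$ be any set of $n$ distinct positive integers, let $m>0$ be a real number, and let $f(x)=x^m$ for all positive integers $x$. Then (a) $(S)_f$ is positive definite; (b) $[S]_f$ is indefinite for $n\ge 2$.
   Context: $(S)_f$ is the $n\times n$ matrix with $ij$ entry $f(\gcd(x_i,x_j))$ (the GCD matrix), and $[S]_f$ is the $n\times n$ matrix with $ij$ entry $f(\operatorname{lcm}(x_i,x_j))$ (the LCM matrix). A real symmetric matrix is indefinite if it is neither positive semidefinite nor negative semidefinite. *)

theory Defs
  imports Complex_Main "Jordan_Normal_Form.Matrix"
begin

text \<open>Matrices have their dimension as a natural number and are indexed from 0, so the set
  \<open>{x\<^sub>1, \<dots>, x\<^sub>n}\<close> is enumerated as \<open>x 0, \<dots>, x (n - 1)\<close>.\<close>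

definition gcd_matrix :: "nat \<Rightarrow> (nat \<Rightarrow> nat) \<Rightarrow> (nat \<Rightarrow> real) \<Rightarrow> real mat" where
  "gcd_matrix n x f = mat n n (\<lambda>(i, j). f (gcd (x i) (x j)))"

definition lcm_matrix :: "nat \<Rightarrow> (nat \<Rightarrow> nat) \<Rightarrow> (nat \<Rightarrow> real) \<Rightarrow> real mat" where
  "lcm_matrix n x f = mat n n (\<lambda>(i, j). f (lcm (x i) (x j)))"

text \<open>The equation \<open>A\<^sup>T = A\<close> forces \<open>A\<close> to be square.\<close>

definition symmetric_matrix :: "real mat \<Rightarrow> bool" where
  "symmetric_matrix A \<longleftrightarrow> A\<^sup>T = A"

definition positive_definite :: "real mat \<Rightarrow> bool" where
  "positive_definite A \<longleftrightarrow> symmetric_matrix A \<and>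
     (\<forall>v \<in> carrier_vec (dim_row A). v \<noteq> 0\<^sub>v (dim_row A) \<longrightarrow> v \<bullet> (A *\<^sub>v v) > 0)"

definition positive_semidefinite :: "real mat \<Rightarrow> bool" where
  "positive_semidefinite A \<longleftrightarrow> symmetric_matrix A \<and>
     (\<forall>v \<in> carrier_vec (dim_row A). v \<bullet> (A *\<^sub>v v) \<ge> 0)"

definition negative_semidefinite :: "real mat \<Rightarrow> bool" where
  "negative_semidefinite A \<longleftrightarrow> symmetric_matrix A \<and>
     (\<forall>v \<in> carrier_vec (dim_row A). v \<bullet> (A *\<^sub>v v) \<le> 0)"

definition indefinite :: "real mat \<Rightarrow> bool" where
  "indefinite A \<longleftrightarrow> symmetric_matrix A \<and>
     \<not> positive_semidefinite A \<and> \<not> negative_semidefinite A"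

end

theory Submission
  imports Defs "HOL-Computational_Algebra.Primes"
begin

text \<open>
  For the GCD matrix, the reason is a sum of squares. Suppose that \<open>f k = (\<Sum>d | d dvd k. g d)\<close>.
  Since \<open>d dvd gcd a b\<close> iff \<open>d\<close> divides both \<open>a\<close> and \<open>b\<close>, exchanging sums turns the quadratic form
  into \<open>\<Sum>\<^sub>d g d * (\<Sum>{v\<^sub>i | d dvd x\<^sub>i})\<^sup>2\<close> (lemma \<open>gcd_quadratic_form\<close>). If \<open>g\<close> is positive, this is
  nonnegative, and it can only vanish when every inner sum does. Choosing \<open>d\<close> to be the largest
  \<open>x\<^sub>i\<close> with \<open>v\<^sub>i \<noteq> 0\<close> leaves \<open>v\<^sub>i\<close> as the only nonzero term of that inner sum, so \<open>v = 0\<close>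
  (lemma \<open>positive_definite_gcd_matrix\<close>).

  It remains to write \<open>k powr m\<close> as a divisor sum of a positive function. That function is Jordan's
  totient with a real exponent, positive because \<open>p powr (-m) < 1\<close> for \<open>m > 0\<close>, and the
  identity is proved by adding one power of a prime at a time (lemma \<open>sum_jordan_totient_divisors\<close>).

  For the LCM matrix it is enough that \<open>f\<close> is positive and strictly increasing, and only a
  \<open>2 \<times> 2\<close> principal submatrix matters. Its diagonal entries \<open>f a\<close>, \<open>f b\<close> are positive, which
  excludes negative semidefiniteness. Since \<open>a \<noteq> b\<close>, the off-diagonal entry \<open>f (lcm a b)\<close> is at
  least the larger of \<open>f a\<close>, \<open>f b\<close> and exceeds the smaller, so the form takes the negative value
  \<open>f a + f b - 2 * f (lcm a b)\<close> at \<open>e\<^sub>1 - e\<^sub>2\<close> (lemma \<open>indefinite_lcm_matrix\<close>).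
\<close>

section \<open>Jordan's totient with a real exponent\<close>

definition jordan_totient :: "real \<Rightarrow> nat \<Rightarrow> real" where
  "jordan_totient m d = real d powr m * (\<Prod>p\<in>prime_factors d. 1 - real p powr (-m))"

lemma jordan_totient_pos:
  assumes "m > 0" "d > 0"
  shows "jordan_totient m d > 0"
proof -
  have "1 - real p powr (-m) > 0" if "p \<in> prime_factors d" for p
  proof -
    have "p > 1" using that prime_gt_1_nat by blast
    then have "real p powr (-m) < real p powr 0"
      using assms(1) by (intro powr_less_mono) auto
    then show ?thesis using \<open>p > 1\<close> by simp
  qed
  then have "(\<Prod>p\<in>prime_factors d. 1 - real p powr (-m)) > 0" by (intro prod_pos) auto
  then show ?thesis using assms(2) by (simp add: jordan_totient_def)
qed

text \<open>The only new prime factor is \<open>p\<close>, and its factor \<open>1 - real p powr (-m)\<close> turns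
  \<open>real (p ^ Suc e) powr m\<close> into the difference that makes later sums over \<open>e\<close> telescope.\<close>

lemma jordan_totient_prime_power_mult:
  assumes p: "prime p" and nd: "\<not> p dvd d"
  shows "jordan_totient m (p ^ Suc e * d)
    = (real (p ^ Suc e) powr m - real (p ^ e) powr m) * jordan_totient m d"
proof -
  have p0: "p > 0" using p prime_gt_0_nat by blast
  have d0: "d \<noteq> 0" using nd by (metis dvd_0_right)
  have "prime_factors (p ^ Suc e * d) = insert p (prime_factors d)"
    using p p0 d0
    by (simp add: prime_factors_product prime_factorization_prime_power del: power_Suc)
  moreover have "p \<notin> prime_factors d" using nd by auto
  ultimately have "(\<Prod>q\<in>prime_factors (p ^ Suc e * d). 1 - real q powr (-m))
    = (1 - real p powr (-m)) * (\<Prod>q\<in>prime_factors d. 1 - real q powr (-m))" by simp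
  moreover have "real (p ^ Suc e) powr m * real p powr (-m) = real (p ^ e) powr m"
    using p0 by (simp add: powr_mult powr_minus field_simps)
  moreover have "A * B * ((1 - P) * X) = (A - C) * (B * X)" if "A * P = C" for A B C P X :: real
    using that by (simp add: algebra_simps flip: that)
  ultimately show ?thesis
    unfolding jordan_totient_def of_nat_mult[of "p ^ Suc e"] powr_mult by presburger
qed

text \<open>Writing a divisor as \<open>p ^ i * c\<close> with \<open>p\<close> not dividing \<open>c\<close>, coprimality gives \<open>c dvd r\<close> and
  \<open>i \<le> Suc e\<close>; the new divisors are those with \<open>i = Suc e\<close>.\<close>

lemma divisors_prime_power_Suc_mult:
  fixes p r :: nat
  assumes p: "prime p" and r: "\<not> p dvd r"
  shows "{d. d dvd p ^ Suc e * r} =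
    {d. d dvd p ^ e * r} \<union> (\<lambda>d. p ^ Suc e * d) ` {d. d dvd r}" (is "?L = ?A \<union> ?B")
proof
  show "?A \<union> ?B \<subseteq> ?L"
    by (auto simp del: power_Suc intro: mult_dvd_mono)
       (auto intro: dvd_trans)
  show "?L \<subseteq> ?A \<union> ?B"
  proof
    fix d assume "d \<in> ?L"
    then have d: "d dvd p ^ Suc e * r" by simp
    have r0: "r \<noteq> 0" using r by (metis dvd_0_right)
    have "p \<noteq> 0" using p by auto
    then have "d \<noteq> 0" using d r0 by (metis dvd_0_left_iff mult_eq_0_iff power_not_zero)
    then obtain i c where ic: "d = p ^ i * c" "\<not> p dvd c"
      using p by (metis multiplicity_decompose' not_prime_unit)
    have "coprime c (p ^ Suc e)"
      using p ic(2) by (metis prime_imp_coprime coprime_commute coprime_power_right_iff)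
    then have c: "c dvd r" using d ic(1)
      by (metis coprime_dvd_mult_right_iff dvd_mult_right)
    have "coprime (p ^ i) r"
      using p r by (metis prime_imp_coprime coprime_power_left_iff)
    then have "p ^ i dvd p ^ Suc e"
      using d ic(1) by (metis coprime_dvd_mult_left_iff dvd_mult_left)
    then have "i \<le> Suc e"
      using p by (meson power_dvd_imp_le prime_gt_1_nat)
    then consider "i \<le> e" | "i = Suc e" by linarith
    then show "d \<in> ?A \<union> ?B"
    proof cases
      case 1
      then show ?thesis using ic c by (auto intro: mult_dvd_mono le_imp_power_dvd)
    next
      case 2
      then show ?thesis using ic c by auto
    qed
  qed
qed

text \<open>Passing from \<open>p ^ e * r\<close> to \<open>p ^ Suc e * r\<close> with \<open>p\<close> not dividing \<open>r\<close> adds the divisors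
  \<open>p ^ Suc e * d\<close> with \<open>d dvd r\<close>. By multiplicativity they contribute the difference of the values
  at \<open>p ^ Suc e\<close> and \<open>p ^ e\<close>, times the sum for \<open>r\<close>, so the sum over \<open>e\<close> telescopes.\<close>

lemma sum_jordan_totient_divisors:
  assumes "k > 0"
  shows "(\<Sum>d | d dvd k. jordan_totient m d) = real k powr m"
  using assms
proof (induction k rule: less_induct)
  case (less k)
  show ?case
  proof (cases "k = 1")
    case True
    then show ?thesis by (simp add: jordan_totient_def)
  next
    case False
    then obtain p where p: "prime p" "p dvd k" using prime_factor_nat by blast
    obtain e r where er: "k = p ^ e * r" "\<not> p dvd r"
      using p(1) less.prems by (metis multiplicity_decompose' not_prime_unit not_gr_zero)
    have r0: "r > 0" using er less.prems by (auto intro: Nat.gr0I)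
    have "e \<noteq> 0" using er p(2) by (cases e) auto
    then have "p ^ e > 1" using p(1) by (metis one_less_power prime_gt_1_nat not_gr_zero)
    then have "r < k" using er(1) r0 by simp
    then have sum_r: "(\<Sum>d | d dvd r. jordan_totient m d) = real r powr m"
      using less.IH r0 by blast
    have p0: "p > 0" using p(1) prime_gt_0_nat by blast
    have "(\<Sum>d | d dvd p ^ j * r. jordan_totient m d) = real (p ^ j * r) powr m" for j
    proof (induction j)
      case 0
      then show ?case using sum_r by simp
    next
      case (Suc j)
      let ?A = "{d. d dvd p ^ j * r}" and ?D = "{d. d dvd r}"
      let ?B = "(\<lambda>d. p ^ Suc j * d) ` ?D"
      have fin: "finite ?A" "finite ?D" using p0 r0 by auto
      have disj: "?A \<inter> ?B = {}"
      proof -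
        have "\<not> p ^ Suc j * d dvd p ^ j * r" for d
        proof
          assume "p ^ Suc j * d dvd p ^ j * r"
          then have "p ^ j * (p * d) dvd p ^ j * r" by (simp add: ac_simps)
          then have "p * d dvd r" using p0 by simp
          then show False using er(2) by (metis dvd_mult_left)
        qed
        then show ?thesis by blast
      qed
      have inj: "inj_on (\<lambda>d. p ^ Suc j * d) ?D" using p0 by (auto simp: inj_on_def)
      have "(\<Sum>d\<in>?B. jordan_totient m d) = (\<Sum>d\<in>?D. jordan_totient m (p ^ Suc j * d))"
        using inj by (simp add: sum.reindex del: power_Suc)
      also have "\<dots> = (\<Sum>d\<in>?D. (real (p ^ Suc j) powr m - real (p ^ j) powr m)
          * jordan_totient m d)"
        using er(2) p(1)
        by (intro sum.cong refl jordan_totient_prime_power_mult) (auto dest: dvd_trans)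
      also have "\<dots> = (real (p ^ Suc j) powr m - real (p ^ j) powr m) * real r powr m"
        by (simp only: sum_distrib_left[symmetric] sum_r)
      finally have B: "(\<Sum>d\<in>?B. jordan_totient m d) = \<dots>" .
      have "(\<Sum>d | d dvd p ^ Suc j * r. jordan_totient m d)
        = (\<Sum>d\<in>?A. jordan_totient m d) + (\<Sum>d\<in>?B. jordan_totient m d)"
        unfolding divisors_prime_power_Suc_mult[OF p(1) er(2)]
        using fin disj by (intro sum.union_disjoint) auto
      also have "\<dots> = real (p ^ Suc j * r) powr m"
        unfolding Suc.IH B of_nat_mult powr_mult by (simp add: powr_mult algebra_simps)
      finally show ?case .
    qed
    then show ?thesis using er(1) by simp
  qed
qed

section \<open>Quadratic forms of GCD and LCM matrices\<close>

lemma quadratic_form_mat: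
  fixes v :: "real vec"
  assumes "v \<in> carrier_vec n"
  shows "v \<bullet> (mat n n (\<lambda>(i, j). g i j) *\<^sub>v v) = (\<Sum>i<n. \<Sum>j<n. g i j * v $ i * v $ j)"
  using assms
  by (simp add: scalar_prod_def sum_distrib_left atLeast0LessThan algebra_simps)

lemma symmetric_matrix_mat:
  assumes "\<And>i j. g i j = g j i"
  shows "symmetric_matrix (mat n n (\<lambda>(i, j). g i j))"
  using assms unfolding symmetric_matrix_def by (intro eq_matI) auto

text \<open>The index set \<open>D\<close> may be any finite set that contains all the divisors involved, since an
  element dividing no \<open>x i\<close> contributes an empty inner sum.\<close>

lemma gcd_quadratic_form:
  fixes f g :: "nat \<Rightarrow> real"
  assumes pos: "\<And>i. i < n \<Longrightarrow> x i > 0"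
    and f: "\<And>k. k > 0 \<Longrightarrow> f k = (\<Sum>d | d dvd k. g d)"
    and D: "finite D" "\<And>i. i < n \<Longrightarrow> {d. d dvd x i} \<subseteq> D"
    and v: "v \<in> carrier_vec n"
  shows "v \<bullet> (gcd_matrix n x f *\<^sub>v v) = (\<Sum>d\<in>D. g d * (\<Sum>i | i < n \<and> d dvd x i. v $ i)\<^sup>2)"
proof -
  let ?u = "\<lambda>d i. if d dvd x i then v $ i else 0"
  have entry: "f (gcd (x i) (x j)) * v $ i * v $ j = (\<Sum>d\<in>D. g d * ?u d i * ?u d j)"
    if "i < n" "j < n" for i j
  proof -
    have "f (gcd (x i) (x j)) * v $ i * v $ j
      = (\<Sum>d | d dvd gcd (x i) (x j). g d * v $ i * v $ j)"
      using f pos[OF that(1)] by (simp add: sum_distrib_right)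
    also have "\<dots> = (\<Sum>d\<in>D. g d * ?u d i * ?u d j)"
      using D that by (intro sum.mono_neutral_cong_left) auto
    finally show ?thesis .
  qed
  have "v \<bullet> (gcd_matrix n x f *\<^sub>v v)
    = (\<Sum>i<n. \<Sum>j<n. f (gcd (x i) (x j)) * v $ i * v $ j)"
    unfolding gcd_matrix_def using v by (rule quadratic_form_mat)
  also have "\<dots> = (\<Sum>i<n. \<Sum>j<n. \<Sum>d\<in>D. g d * ?u d i * ?u d j)"
    by (intro sum.cong refl entry) auto
  also have "\<dots> = (\<Sum>i<n. \<Sum>d\<in>D. \<Sum>j<n. g d * ?u d i * ?u d j)"
    by (intro sum.cong refl sum.swap)
  also have "\<dots> = (\<Sum>d\<in>D. \<Sum>i<n. \<Sum>j<n. g d * ?u d i * ?u d j)"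
    by (rule sum.swap)
  also have "\<dots> = (\<Sum>d\<in>D. g d * (\<Sum>i<n. ?u d i)\<^sup>2)"
    unfolding power2_eq_square sum_product by (simp only: sum_distrib_left mult.assoc)
  also have "\<dots> = (\<Sum>d\<in>D. g d * (\<Sum>i | i < n \<and> d dvd x i. v $ i)\<^sup>2)"
    by (simp add: sum.inter_filter[symmetric])
  finally show ?thesis .
qed

lemma positive_definite_gcd_matrix:
  fixes f g :: "nat \<Rightarrow> real"
  assumes distinct: "inj_on x {..<n}"
    and pos: "\<And>i. i < n \<Longrightarrow> x i > 0"
    and f: "\<And>k. k > 0 \<Longrightarrow> f k = (\<Sum>d | d dvd k. g d)"
    and g: "\<And>d. d > 0 \<Longrightarrow> g d > 0"
  shows "positive_definite (gcd_matrix n x f)"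
proof -
  have sym: "symmetric_matrix (gcd_matrix n x f)"
    unfolding gcd_matrix_def by (intro symmetric_matrix_mat) (simp add: gcd.commute)
  have "v \<bullet> (gcd_matrix n x f *\<^sub>v v) > 0" if v: "v \<in> carrier_vec n" and nz: "v \<noteq> 0\<^sub>v n" for v
  proof -
    define D where "D = (\<Union>i<n. {d. d dvd x i})"
    let ?s = "\<lambda>d. \<Sum>i | i < n \<and> d dvd x i. v $ i"
    have fin: "finite D" using pos by (auto simp: D_def)
    have g_pos: "g d > 0" if "d \<in> D" for d
      using that pos g by (auto simp: D_def dest: dvd_pos_nat)
    define T where "T = {i. i < n \<and> v $ i \<noteq> 0}"
    have "T \<noteq> {}" using v nz by (auto simp: T_def intro!: eq_vecI)
    moreover have "finite T" by (simp add: T_def)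
    ultimately obtain i where i: "i \<in> T" "\<And>j. j \<in> T \<Longrightarrow> x j \<le> x i"
      using obtains_MAX[of T x] by (metis Max_ge finite_imageI imageI)
    \<comment> \<open>A proper multiple of \<open>x i\<close> is larger than \<open>x i\<close>, so by maximality its coefficient is zero.\<close>
    have "?s (x i) = (\<Sum>j\<in>{i}. v $ j)"
    proof (rule sum.mono_neutral_right)
      show "\<forall>j\<in>{j. j < n \<and> x i dvd x j} - {i}. v $ j = 0"
      proof (rule ballI, rule ccontr)
        fix j assume j: "j \<in> {j. j < n \<and> x i dvd x j} - {i}" and "v $ j \<noteq> 0"
        then have "x j \<le> x i" using i(2) by (auto simp: T_def)
        moreover have "x i \<le> x j" using j pos by (auto intro: dvd_imp_le)
        ultimately have "j = i"
          using distinct i(1) j by (auto simp: T_def inj_on_def)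
        then show False using j by simp
      qed
    qed (use i in \<open>auto simp: T_def\<close>)
    then have "?s (x i) \<noteq> 0" using i(1) by (simp add: T_def)
    moreover have "x i \<in> D" using i(1) by (auto simp: D_def T_def intro!: bexI[of _ i])
    ultimately have "(\<Sum>d\<in>D. g d * (?s d)\<^sup>2) > 0"
      using fin g_pos
      by (intro sum_pos2[of D "x i"]) (simp_all add: less_imp_le)
    moreover have "v \<bullet> (gcd_matrix n x f *\<^sub>v v) = (\<Sum>d\<in>D. g d * (?s d)\<^sup>2)"
      by (rule gcd_quadratic_form[OF pos f fin _ v]) (auto simp: D_def)
    ultimately show ?thesis by simp
  qed
  then show ?thesis
    using sym by (simp add: positive_definite_def) (simp add: gcd_matrix_def)
qed

lemma indefinite_lcm_matrix:
  fixes f :: "nat \<Rightarrow> real"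
  assumes distinct: "inj_on x {..<n}"
    and pos: "\<And>i. i < n \<Longrightarrow> x i > 0"
    and f_pos: "\<And>k. k > 0 \<Longrightarrow> f k > 0"
    and f_less: "\<And>k l. 0 < k \<Longrightarrow> k < l \<Longrightarrow> f k < f l"
    and n: "n \<ge> 2"
  shows "indefinite (lcm_matrix n x f)"
proof -
  let ?Q = "\<lambda>v. v \<bullet> (lcm_matrix n x f *\<^sub>v v)"
  have sym: "symmetric_matrix (lcm_matrix n x f)"
    unfolding lcm_matrix_def by (intro symmetric_matrix_mat) (simp add: lcm.commute)
  have dim: "dim_row (lcm_matrix n x f) = n" by (simp add: lcm_matrix_def)
  have Q: "?Q v = (\<Sum>i<n. \<Sum>j<n. f (lcm (x i) (x j)) * v $ i * v $ j)"
    if "v \<in> carrier_vec n" for v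
    unfolding lcm_matrix_def using that by (rule quadratic_form_mat)
  define w :: "real \<Rightarrow> real vec" where
    "w c = vec n (\<lambda>i. if i = 0 then 1 else if i = 1 then c else 0)" for c
  have w_carrier: "w c \<in> carrier_vec n" for c by (simp add: w_def)
  have Q_w: "?Q (w c) = f (x 0) + 2 * c * f (lcm (x 0) (x 1)) + c\<^sup>2 * f (x 1)" for c
  proof -
    have restrict: "(\<Sum>i<n. h i * w c $ i) = h 0 + c * h 1" for h :: "nat \<Rightarrow> real"
    proof -
      have "(\<Sum>i<n. h i * w c $ i) = (\<Sum>i\<in>{0, 1}. h i * w c $ i)"
        using n by (intro sum.mono_neutral_right) (auto simp: w_def)
      then show ?thesis using n by (simp add: w_def)
    qed
    have "?Q (w c) = (\<Sum>i<n. (\<Sum>j<n. f (lcm (x i) (x j)) * w c $ j) * w c $ i)"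
      by (subst Q) (simp_all add: w_carrier sum_distrib_left ac_simps)
    also have "\<dots> = f (x 0) + 2 * c * f (lcm (x 0) (x 1)) + c\<^sup>2 * f (x 1)"
      unfolding restrict by (simp add: lcm.commute power2_eq_square algebra_simps)
    finally show ?thesis .
  qed
  have x01: "x 0 > 0" "x 1 > 0" "x 0 \<noteq> x 1"
    using pos n inj_onD[OF distinct, of 0 1] by auto
  let ?l = "lcm (x 0) (x 1)"
  have f_mono: "f k \<le> f l" if "0 < k" "k \<le> l" for k l
    using f_less[of k l] that by (cases "k = l") auto
  have l: "x 0 \<le> ?l" "x 1 \<le> ?l"
    using x01 by (auto intro!: dvd_imp_le lcm_pos_nat)
  have "f (x 0) + f (x 1) < 2 * f ?l"
  proof (cases "x 0 < x 1")
    case True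
    then have "f (x 0) < f (x 1)" using f_less x01 by blast
    then show ?thesis using f_mono[OF x01(2) l(2)] by linarith
  next
    case False
    then have "f (x 1) < f (x 0)" using f_less x01 by simp
    then show ?thesis using f_mono[OF x01(1) l(1)] by linarith
  qed
  \<comment> \<open>\<open>w (-1)\<close> is \<open>e\<^sub>1 - e\<^sub>2\<close> and \<open>w 0\<close> is \<open>e\<^sub>1\<close>.\<close>
  then have "?Q (w (-1)) < 0" unfolding Q_w by simp
  moreover have "?Q (w 0) > 0" unfolding Q_w using f_pos x01 by simp
  ultimately have "\<not> positive_semidefinite (lcm_matrix n x f)"
    "\<not> negative_semidefinite (lcm_matrix n x f)"
    unfolding positive_semidefinite_def negative_semidefinite_def dim
    using w_carrier by (meson not_le)+
  then show ?thesis using sym by (simp add: indefinite_def)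
qed

theorem theorem5p3:
  fixes n :: nat and x :: "nat \<Rightarrow> nat" and m :: real and f :: "nat \<Rightarrow> real"
  assumes distinct: "inj_on x {..<n}"
    and positive: "\<And>i. i < n \<Longrightarrow> x i > 0"
    and m_pos: "m > 0"
    and f: "\<And>k. k > 0 \<Longrightarrow> f k = real k powr m"
  shows "positive_definite (gcd_matrix n x f) \<and>
    (n \<ge> 2 \<longrightarrow> indefinite (lcm_matrix n x f))"
proof (intro conjI impI)
  show "positive_definite (gcd_matrix n x f)"
    using distinct positive
  proof (rule positive_definite_gcd_matrix)
    show "f k = (\<Sum>d | d dvd k. jordan_totient m d)" if "k > 0" for k
      using that f by (simp add: sum_jordan_totient_divisors)
    show "jordan_totient m d > 0" if "d > 0" for d
      using m_pos that by (rule jordan_totient_pos)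
  qed
next
  assume "n \<ge> 2"
  show "indefinite (lcm_matrix n x f)"
  proof (rule indefinite_lcm_matrix[OF distinct positive _ _ \<open>n \<ge> 2\<close>])
    show "f k > 0" if "k > 0" for k
      using that f by simp
    show "f k < f l" if "0 < k" "k < l" for k l
      using that f m_pos by (simp add: powr_less_mono2)
  qed
qed

end
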